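(* Let $R$ be an associative ring with unity $1$, and let $p, q \in R$ be idempotents (i.e. $p^2=p$ and $q^2=q$). Then the following statements are equivalent: (1) $pq+qp\in R^D$; (2) $pq\in R^D$ and $p+q\in R^D$.
   Context: An element $a\in R$ is Drazin invertible if there exists $b\in R$ such that $ab=ba$, $bab=b$, and $a^k=a^{k+1}b$ for some positive integer $k$; such $b$ is unique if it exists and is denoted $a^D$. $R^D$ denotes the set of all Drazin invertible elements of $R$. The ring $R$ is not assumed commutative. *)

theory Defs
  imports Main
begin

definition is_drazin_inverse :: "'a::{ring, monoid_mult} \<Rightarrow> 'a \<Rightarrow> bool" where
  "is_drazin_inverse a b \<longleftrightarrow>
     a * b = b * a \<and> b * a * b = b \<and> (\<exists>k::nat. k > 0 \<and> a ^ k = a ^ (k + 1) * b)"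

(* The sort {ring, monoid_mult} is that of associative rings with unity, not assumed commutative.
   In contrast to the class ring_1 it does not exclude the zero ring. *)
definition drazin_invertibles :: "'a::{ring, monoid_mult} set" where
  "drazin_invertibles = {a. \<exists>b. is_drazin_inverse a b}"

end

theory Submission
  imports Defs
begin

text \<open>
  Put \<open>s = p + q\<close>. Then \<open>pq + qp = s (s - 1)\<close>, and since \<open>s\<close> and \<open>s - 1\<close> commute and are comaximal,
  their product is Drazin invertible iff both are. The element \<open>e = (s - 1)\<^sup>2\<close> commutes with \<open>p\<close>
  and \<open>q\<close>, and \<open>(pq)\<^sup>n\<^sup>+\<^sup>1 = e\<^sup>n pq\<close>. Hence a Drazin inverse of \<open>e\<close> gives one of \<open>pq\<close>. Conversely, if
  \<open>pq\<close> is Drazin invertible, then \<open>p e\<^sup>k\<close> and \<open>q e\<^sup>k\<close> are multiples of \<open>e\<^sup>k\<^sup>+\<^sup>1\<close> for large \<open>k\<close>, so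
  multiplying \<open>1 = e + p (1 - q) + q (1 - p)\<close> by \<open>e\<^sup>k\<close> exhibits \<open>e\<^sup>k\<close> as a multiple of \<open>e\<^sup>k\<^sup>+\<^sup>1\<close>.
\<close>

section \<open>Commuting elements and their powers\<close>

lemma mult_left_commute_of_commute:
  fixes x y z :: "'a::semigroup_mult"
  assumes "x * y = y * x"
  shows "x * (y * z) = y * (x * z)"
  using assms by (metis mult.assoc)

lemma commute_mult:
  fixes x y z :: "'a::semigroup_mult"
  assumes "z * x = x * z" and "z * y = y * z"
  shows "z * (x * y) = x * y * z"
  using assms by (metis mult.assoc)

lemma commute_power:
  fixes x z :: "'a::monoid_mult"
  assumes "z * x = x * z"
  shows "z * x ^ n = x ^ n * z"
  using assms by (metis power_commuting_commutes)

lemma mult_power_of_commute: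
  fixes x y :: "'a::monoid_mult"
  assumes "x * y = y * x"
  shows "(x * y) ^ n = x ^ n * y ^ n"
proof (induction n)
  case (Suc n)
  have "y * x ^ n = x ^ n * y"
    using assms by (intro commute_power) simp
  then show ?case
    by (simp add: Suc mult.assoc mult_left_commute_of_commute)
qed simp

text \<open>The hypothesis is substituted into itself \<open>j\<close> times, each time gaining one
  factor \<open>a\<close> and one factor \<open>x\<close>. It serves to raise exponents at
  will.\<close>

lemma power_absorb_add:
  fixes a x :: "'a::monoid_mult"
  assumes comm: "a * x = x * a" and n: "a ^ n = a ^ (n + 1) * x"
  shows "a ^ (n + i) = a ^ (n + i + j) * x ^ j"
proof (induction j)
  case (Suc j)
  have "a ^ (n + i) = a ^ (i + j) * a ^ n * x ^ j"
    using Suc by (simp add: power_add[symmetric] add_ac)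
  also have "\<dots> = a ^ (i + j) * a ^ (n + 1) * (x * x ^ j)"
    by (subst n) (simp only: mult.assoc)
  also have "\<dots> = a ^ (n + i + Suc j) * x ^ Suc j"
    by (simp only: power_add[symmetric] power_Suc[symmetric]) (simp add: add_ac)
  finally show ?case .
qed simp

section \<open>A weaker criterion for Drazin invertibility, and the double commutant
  property\<close>

lemma drazin_invertibleI:
  fixes a x :: "'a::{ring, monoid_mult}"
  assumes comm: "a * x = x * a" and n: "a ^ n = a ^ (n + 1) * x"
  shows "a \<in> drazin_invertibles"
proof -
  \<comment> \<open>The shift makes the exponent positive even for \<open>n = 0\<close>. As
    \<open>x * a * x = x\<close> may fail, \<open>x\<close> is replaced by \<open>b\<close>, whose
    surplus factors cancel through \<open>absorb\<close>.\<close>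
  define m where "m = Suc n"
  define b where "b = a ^ m * x ^ Suc m"
  have absorb: "a ^ (m + i) = a ^ (m + i + j) * x ^ j" for i j
    using power_absorb_add[OF comm n, of "Suc i" j] by (simp add: m_def)
  have ax: "x ^ i * a ^ j = a ^ j * x ^ i" for i j
    using comm by (metis power_commuting_commutes)
  have ab: "a * b = b * a"
    unfolding b_def using comm
    by (intro commute_mult commute_power) simp_all
  have step: "a ^ Suc m * b = a ^ m"
    using absorb[of 0 "Suc m"] by (simp add: b_def power_add mult.assoc[symmetric])
  have b_eq: "b = x ^ Suc m * a ^ m"
    by (simp only: b_def ax)
  have "x ^ Suc m * a ^ m * a * b = x ^ Suc m * (a ^ Suc m * b)"
    by (simp only: power_Suc2[of a] mult.assoc)
  then have "b * a * b = x ^ Suc m * (a ^ Suc m * b)"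
    by (simp only: b_eq[symmetric])
  also have "\<dots> = b"
    by (subst step) (rule b_eq[symmetric])
  finally have "b * a * b = b" .
  moreover have "m > 0"
    by (simp add: m_def)
  ultimately show ?thesis
    using ab step unfolding drazin_invertibles_def is_drazin_inverse_def
    by (auto intro!: exI[of _ b] exI[of _ m] simp del: power_Suc)
qed

text \<open>The idempotent \<open>a * b\<close> equals both \<open>a ^ k * b ^ k\<close> and
  \<open>b ^ k * a ^ k\<close>, and \<open>c\<close> can be moved past \<open>a ^ k\<close>. So
  \<open>c\<close> commutes with this idempotent, and from there with \<open>b\<close>.\<close>

lemma drazin_inverse_commute:
  fixes a b c :: "'a::{ring, monoid_mult}"
  assumes inv: "is_drazin_inverse a b" and c: "c * a = a * c"
  shows "c * b = b * c"
proof -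
  obtain k where ab: "a * b = b * a" and bab: "b * a * b = b" and k: "a ^ k = a ^ (k + 1) * b"
    and "k > 0"
    using inv by (auto simp: is_drazin_inverse_def)
  define e where "e = a * b"
  have "e * e = e"
    by (simp add: e_def mult.assoc) (simp add: mult.assoc[symmetric] bab)
  then have "e ^ Suc n = e" for n
    by (induction n) simp_all
  then have "e ^ k = e"
    using \<open>k > 0\<close> by (metis gr0_implies_Suc)
  then have e: "e = a ^ k * b ^ k" "e = b ^ k * a ^ k"
    using mult_power_of_commute[OF ab, of k] mult_power_of_commute[OF ab[symmetric], of k] ab
    by (simp_all add: e_def)
  have eak: "e * a ^ k = a ^ k" and ake: "a ^ k * e = a ^ k"
  proof -
    show "a ^ k * e = a ^ k"
      using k by (simp add: e_def power_Suc2 mult.assoc[symmetric] del: power_Suc)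
    moreover have "a * e = e * a"
      unfolding e_def using ab by (intro commute_mult) simp_all
    ultimately show "e * a ^ k = a ^ k"
      by (metis commute_power)
  qed
  have cak: "c * a ^ k = a ^ k * c"
    using c by (rule commute_power)
  \<comment> \<open>With \<open>a ^ k\<close> now in front, \<open>eak\<close> allows an
    \<open>e\<close> to be inserted on the left; the mirror argument below inserts one on the
    right.\<close>
  have "c * e = a ^ k * c * b ^ k"
    by (simp add: e(1) mult.assoc[symmetric] cak)
  then have 1: "c * e = e * c * e"
    by (metis cak e(1) eak mult.assoc)
  have "e * c = b ^ k * c * a ^ k"
    by (subst e(2)) (simp add: mult.assoc cak)
  then have "e * c = e * c * e"
    by (metis ake mult.assoc)
  with 1 have ec: "e * c = c * e"
    by simp
  have be: "b = b * e" "b = e * b"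
    using bab ab by (simp_all add: e_def mult.assoc)
  have "b * c = b * (c * e)"
    by (metis be(1) ec mult.assoc)
  also have "\<dots> = b * (a * c) * b"
    by (simp only: e_def mult.assoc c[symmetric])
  also have "\<dots> = e * c * b"
    by (simp only: e_def ab mult.assoc)
  also have "\<dots> = c * b"
    by (metis be(2) ec mult.assoc)
  finally show ?thesis by simp
qed

section \<open>Commuting products, comaximal factors and squares\<close>

lemma drazin_invertibleE:
  fixes a :: "'a::{ring, monoid_mult}"
  assumes "a \<in> drazin_invertibles"
  obtains b k where "a * b = b * a" "a ^ k = a ^ (k + 1) * b"
    "\<And>c. c * a = a * c \<Longrightarrow> c * b = b * c"
  using assms drazin_inverse_commute
  unfolding drazin_invertibles_def is_drazin_inverse_def
  by blast

lemma drazin_invertible_mult: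
  fixes a c :: "'a::{ring, monoid_mult}"
  assumes "a \<in> drazin_invertibles" "c \<in> drazin_invertibles" and ac: "a * c = c * a"
  shows "a * c \<in> drazin_invertibles"
proof -
  obtain b k where b: "a * b = b * a" "a ^ k = a ^ (k + 1) * b"
      "\<And>z. z * a = a * z \<Longrightarrow> z * b = b * z"
    using assms(1) by (rule drazin_invertibleE) blast
  obtain d l where d: "c * d = d * c" "c ^ l = c ^ (l + 1) * d"
      "\<And>z. z * c = c * z \<Longrightarrow> z * d = d * z"
    using assms(2) by (rule drazin_invertibleE) blast
  have cb: "c * b = b * c" and ad: "a * d = d * a"
    using ac b(3) d(3) by simp_all
  \<comment> \<open>A common exponent for both factors, so that \<open>b * d\<close> serves as
    witness for the product.\<close>
  define n where "n = k + l"
  have an: "a ^ n = a ^ Suc n * b" and cn: "c ^ n = c ^ Suc n * d"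
    using power_absorb_add[OF b(1,2), of l 1] power_absorb_add[OF d(1,2), of k 1]
    by (simp_all add: n_def add.commute)
  have bc: "b * c ^ Suc n = c ^ Suc n * b"
    using cb by (intro commute_power) simp
  have "(a * c) ^ n = a ^ Suc n * (b * c ^ Suc n) * d"
    by (metis an cn mult.assoc mult_power_of_commute[OF ac])
  also have "\<dots> = (a * c) ^ (n + 1) * (b * d)"
    by (simp only: bc mult_left_commute_of_commute[OF bc] mult_power_of_commute[OF ac] mult.assoc
        Suc_eq_plus1[symmetric])
  finally have "(a * c) ^ n = (a * c) ^ (n + 1) * (b * d)" .
  moreover have "a * c * (b * d) = b * d * (a * c)"
    by (metis ad b(1) cb commute_mult d(1))
  ultimately show ?thesis
    by (intro drazin_invertibleI)
qed

text \<open>Comaximality passes from \<open>c\<close> to \<open>c ^ n\<close>. Multiplying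
  \<open>a * w + c ^ n * v ^ n = 1\<close> by \<open>a ^ n\<close> produces
  \<open>(a * c) ^ n\<close>, which is a multiple of \<open>a ^ (n + 1)\<close> because
  \<open>a * c\<close> is Drazin invertible.\<close>

lemma drazin_invertible_comaximal_factor:
  fixes a c u v :: "'a::{ring, monoid_mult}"
  assumes prod: "a * c \<in> drazin_invertibles" and one: "a * u + c * v = 1"
    and ac: "a * c = c * a" and au: "a * u = u * a" and av: "a * v = v * a" and cv: "c * v = v * c"
  shows "a \<in> drazin_invertibles"
proof -
  have bezout: "\<exists>w. a * w = w * a \<and> a * w + c ^ n * v ^ n = 1" for n
  proof (induction n)
    case 0
    show ?case by (intro exI[of _ 0]) simp
  next
    case (Suc n)
    then obtain w where w: "a * w = w * a" "a * w + c ^ n * v ^ n = 1"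
      by blast
    define r where "r = c ^ n * v ^ n"
    have ar: "a * r = r * a"
      unfolding r_def using ac av by (intro commute_mult commute_power) 
    have vc: "v ^ n * c = c * v ^ n"
      using cv by (metis power_commuting_commutes)
    have "r * (c * v) = c ^ Suc n * v ^ Suc n"
      by (simp add: r_def mult.assoc power_Suc2 mult_left_commute_of_commute[OF vc] del: power_Suc)
    \<comment> \<open>The old remainder \<open>r\<close> is multiplied by
      \<open>1 = a * u + c * v\<close>, which makes \<open>w + r * u\<close> the next coefficient of
      \<open>a\<close>.\<close>
    moreover have "a * w + r * (a * u + c * v) = 1"
      using w(2) one by (simp add: r_def)
    ultimately have "a * (w + r * u) + c ^ Suc n * v ^ Suc n = 1"
      by (simp only: distrib_left mult.assoc[symmetric] ar add.assoc)
    moreover have "a * (w + r * u) = (w + r * u) * a"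
      using w(1) commute_mult[OF ar au] by (simp only: distrib_left distrib_right)
    ultimately show ?case by blast
  qed
  obtain b n where b: "a * c * b = b * (a * c)" "(a * c) ^ n = (a * c) ^ (n + 1) * b"
      "\<And>z. z * (a * c) = a * c * z \<Longrightarrow> z * b = b * z"
    using prod by (rule drazin_invertibleE) blast
  obtain w where w: "a * w = w * a" "a * w + c ^ n * v ^ n = 1"
    using bezout by blast
  have ab: "a * b = b * a"
    using ac by (intro b(3) commute_mult) simp_all
  have "a ^ n = a ^ n * (a * w + c ^ n * v ^ n)"
    using w by simp
  also have "\<dots> = a ^ (n + 1) * w + (a * c) ^ n * v ^ n"
    by (simp add: distrib_left mult.assoc[symmetric] mult_power_of_commute[OF ac] power_Suc2
        del: power_Suc)
  also have "\<dots> = a ^ (n + 1) * (w + c ^ (n + 1) * b * v ^ n)"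
    by (subst b(2)) (simp only: mult_power_of_commute[OF ac] distrib_left mult.assoc)
  finally have "a ^ n = a ^ (n + 1) * (w + c ^ (n + 1) * b * v ^ n)" .
  moreover have "a * (c ^ (n + 1) * b * v ^ n) = c ^ (n + 1) * b * v ^ n * a"
    using ab ac av by (intro commute_mult commute_power)
  then have "a * (w + c ^ (n + 1) * b * v ^ n) = (w + c ^ (n + 1) * b * v ^ n) * a"
    using w(1) by (simp only: distrib_left distrib_right)
  ultimately show ?thesis
    by (intro drazin_invertibleI)
qed

text \<open>Since \<open>a\<close> commutes with its square, it commutes with \<open>b\<close>; one
  of the two extra factors \<open>a\<close> then moves into the witness
  \<open>a * b\<close>.\<close>

lemma drazin_invertible_square_iff:
  fixes a :: "'a::{ring, monoid_mult}"
  shows "a * a \<in> drazin_invertibles \<longleftrightarrow> a \<in> drazin_invertibles"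
proof
  assume "a * a \<in> drazin_invertibles"
  then obtain b n where b: "(a * a) ^ n = (a * a) ^ (n + 1) * b"
      "\<And>z. z * (a * a) = a * a * z \<Longrightarrow> z * b = b * z"
    by (rule drazin_invertibleE) blast
  have ab: "a * b = b * a"
    by (intro b(2)) (simp add: mult.assoc)
  have "a ^ (2 * n) = a ^ (2 * n + 1) * (a * b)"
    using b(1) by (simp add: power_mult power2_eq_square power_Suc2 mult.assoc del: power_Suc)
  moreover have "a * (a * b) = a * b * a"
    using ab by (intro commute_mult) simp_all
  ultimately show "a \<in> drazin_invertibles"
    by (intro drazin_invertibleI)
qed (simp add: drazin_invertible_mult)

section \<open>The product of two idempotents\<close>

lemma drazin_invertible_mult_idempotents_iff:
  fixes p q :: "'a::{ring, monoid_mult}"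
  assumes p: "p * p = p" and q: "q * q = q"
  shows "p * q \<in> drazin_invertibles \<longleftrightarrow> p + q - 1 \<in> drazin_invertibles"
proof -
  define e where "e = (p + q - 1) * (p + q - 1)"
  have absorb: "p * (p * z) = p * z" "q * (q * z) = q * z" for z
    by (simp_all add: mult.assoc[symmetric] p q)
  have pe: "p * e = p * q * p" and ep: "e * p = p * q * p"
    and qe: "q * e = q * p * q" and eq: "e * q = q * p * q"
    and e_one: "e + p * (1 - q) + q * (1 - p) = 1"
    by (simp_all add: e_def algebra_simps absorb p q)
  have comm: "e * p = p * e" "e * q = q * e"
    using pe ep qe eq by simp_all
  have pow: "(p * q) ^ Suc n = e ^ n * (p * q)" for n
  proof (induction n)
    case (Suc n)
    have "p * q * (p * q) = e * (p * q)"
      by (simp only: mult.assoc[symmetric] ep)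
    then show ?case
      using Suc by (metis mult.assoc power_Suc2)
  qed simp
  have "p * q \<in> drazin_invertibles \<longleftrightarrow> e \<in> drazin_invertibles"
  proof
    assume "e \<in> drazin_invertibles"
    then obtain f k where f: "e * f = f * e" "e ^ k = e ^ (k + 1) * f"
        "\<And>z. z * e = e * z \<Longrightarrow> z * f = f * z"
      by (rule drazin_invertibleE) blast
    have pqf: "p * q * f = f * (p * q)"
      using comm by (intro f(3)) (metis commute_mult)
    \<comment> \<open>The exponent is \<open>Suc k\<close> because \<open>pow\<close> needs one
      factor \<open>p * q\<close> to remain.\<close>
    have "(p * q) ^ Suc k = e ^ Suc k * f * (p * q)"
      by (metis Suc_eq_plus1 f(2) pow)
    also have "\<dots> = (p * q) ^ (Suc k + 1) * f"
      by (metis Suc_eq_plus1 mult.assoc pow pqf)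
    finally show "p * q \<in> drazin_invertibles"
      using pqf by (intro drazin_invertibleI)
  next
    assume "p * q \<in> drazin_invertibles"
    then obtain b k where b: "p * q * b = b * (p * q)" "(p * q) ^ k = (p * q) ^ (k + 1) * b"
        "\<And>z. z * (p * q) = p * q * z \<Longrightarrow> z * b = b * z"
      by (rule drazin_invertibleE) blast
    have eb: "e * b = b * e"
      using comm by (intro b(3) commute_mult)
    have qp: "q * e ^ n = e ^ n * q" "p * e ^ n = e ^ n * p" for n
      using comm by (metis commute_power)+
    have pek: "p * e ^ k = (p * q) ^ k * p"
    proof (cases k)
      case (Suc n)
      have "p * e ^ Suc n = e ^ n * (p * q * p)"
        by (simp only: qp(2)) (simp only: power_Suc2 mult.assoc ep)
      then show ?thesis
        unfolding Suc pow by (simp only: mult.assoc)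
    qed simp
    \<comment> \<open>Three extra factors \<open>p * q\<close> are gained: one stays in
      \<open>x\<close>, the other two become powers of \<open>e\<close>. Two are needed because
      passing from \<open>p\<close> to \<open>q\<close> below costs one \<open>e\<close>.\<close>
    define x where "x = p * q * b ^ 3 * p"
    have "(p * q) ^ k = (p * q) ^ Suc (Suc (Suc k)) * b ^ 3"
      using power_absorb_add[OF b(1,2), of 0 3] by (simp only: add_0_right add_Suc_right numeral_3_eq_3)
    then have "(p * q) ^ k = e ^ Suc (Suc k) * (p * q) * b ^ 3"
      by (simp only: pow)
    then have x: "p * e ^ k = e ^ Suc (Suc k) * x"
      by (simp only: pek x_def mult.assoc)
    have ex: "e * x = x * e"
      unfolding x_def using comm eb by (intro commute_mult commute_power)
    have "e ^ Suc k * p = e * (p * e ^ k)"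
      by (simp only: qp power_Suc mult.assoc)
    also have "\<dots> = e ^ Suc (Suc k) * (e * x)"
      by (simp only: x mult.assoc[symmetric] power_commutes)
    finally have pk: "e ^ Suc k * p = e ^ Suc (Suc k) * (e * x)" .
    \<comment> \<open>One \<open>e\<close> is spent on \<open>e * q = q * p * q\<close>, which
      brings in a \<open>p\<close> to which \<open>x\<close> applies.\<close>
    have "e ^ Suc k * q = e ^ k * (q * p * q)"
      by (simp only: power_Suc2 mult.assoc eq)
    also have "\<dots> = q * (p * e ^ k) * q"
      by (metis mult.assoc qp)
    also have "\<dots> = e ^ Suc (Suc k) * (q * x * q)"
      by (metis x mult.assoc qp(1))
    finally have qk: "e ^ Suc k * q = e ^ Suc (Suc k) * (q * x * q)" .
    \<comment> \<open>What remains after multiplying \<open>e_one\<close> by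
      \<open>e ^ Suc k\<close> and extracting \<open>e ^ Suc (Suc k)\<close> from each term by
      \<open>pk\<close> and \<open>qk\<close>.\<close>
    define z where "z = 1 + e * x * (1 - q) + q * x * q * (1 - p)"
    have "e ^ Suc k = e ^ Suc k * (e + p * (1 - q) + q * (1 - p))"
      by (simp only: e_one mult_1_right)
    also have "\<dots> = e ^ Suc k * e + e ^ Suc k * p * (1 - q) + e ^ Suc k * q * (1 - p)"
      by (simp only: distrib_left mult.assoc)
    also have "\<dots> = e ^ (Suc k + 1) * z"
      unfolding pk qk z_def
      by (simp only: distrib_left mult.assoc mult_1_right power_Suc2[symmetric] Suc_eq_plus1[symmetric])
    finally have "e ^ Suc k = e ^ (Suc k + 1) * z" .
    moreover have "e * z = z * e"
    proof -
      have 1: "e * (1 - q) = (1 - q) * e" "e * (1 - p) = (1 - p) * e"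
        using comm by (simp_all add: algebra_simps)
      have "e * (e * x * (1 - q)) = e * x * (1 - q) * e"
        "e * (q * x * q * (1 - p)) = q * x * q * (1 - p) * e"
        by (intro commute_mult 1 ex comm refl)+
      then show ?thesis
        unfolding z_def by (simp only: distrib_left distrib_right mult_1_left mult_1_right)
    qed
    ultimately show "e \<in> drazin_invertibles"
      by (intro drazin_invertibleI)
  qed
  then show ?thesis
    by (simp add: e_def drazin_invertible_square_iff)
qed

theorem theorem3p6:
  fixes p q :: "'a::{ring, monoid_mult}"
  assumes "p ^ 2 = p" and "q ^ 2 = q"
  shows "p * q + q * p \<in> drazin_invertibles \<longleftrightarrow>
    p * q \<in> drazin_invertibles \<and> p + q \<in> drazin_invertibles"
proof -
  have p: "p * p = p" and q: "q * q = q"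
    using assms by (simp_all add: power2_eq_square)
  define s where "s = p + q"
  have prod: "p * q + q * p = s * (s - 1)"
    by (simp add: s_def algebra_simps p q)
  have comm: "s * (s - 1) = (s - 1) * s"
    by (simp add: algebra_simps)
  have "s * (s - 1) \<in> drazin_invertibles \<longleftrightarrow>
    s \<in> drazin_invertibles \<and> s - 1 \<in> drazin_invertibles"
  proof (intro iffI conjI)
    assume D: "s * (s - 1) \<in> drazin_invertibles"
    show "s \<in> drazin_invertibles"
      \<comment> \<open>The comaximality relation is \<open>s - (s - 1) = 1\<close>.\<close>
      by (rule drazin_invertible_comaximal_factor[OF D, where u = 1 and v = "- 1"])
        (simp_all add: algebra_simps)
    show "s - 1 \<in> drazin_invertibles"
      by (rule drazin_invertible_comaximal_factor[OF D[unfolded comm], where u = "- 1" and v = 1])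
        (simp_all add: algebra_simps)
  qed (simp add: drazin_invertible_mult comm)
  then show ?thesis
    using drazin_invertible_mult_idempotents_iff[OF p q] prod by (auto simp: s_def)
qed

end
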